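(* Let $d$ be a positive integer, let $\varphi_1,\varphi_2\in\Phi_d$ with $\varphi_2$ twice differentiable at the origin, and let $\bm{u}$ be a unit vector in $\mathbb{R}^d$. Let $a_1,a_2>0$ and $b_1,b_2\ge 0$ be constants. Then the mapping $$\bm{h}\mapsto b_1\,\varphi_1(\sqrt{a_1}\,\|\bm{h}\|)-b_2\left[\cos^2(\theta(\bm{h},\bm{u}))\,\varphi_2''(\sqrt{a_2}\,\|\bm{h}\|)+\sin^2(\theta(\bm{h},\bm{u}))\,\frac{\varphi_2'(\sqrt{a_2}\,\|\bm{h}\|)}{\sqrt{a_2}\,\|\bm{h}\|}\right],\qquad \bm{h}\in\mathbb{R}^d,$$ where $\theta(\bm{h},\bm{u})$ is the angle between $\bm{h}$ and $\bm{u}$, is a stationary covariance function in $\mathbb{R}^d$.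
   Context: A function $C:\mathbb{R}^d\to\mathbb{R}$ is a stationary covariance function in $\mathbb{R}^d$ if $(\bm{x},\bm{x}')\mapsto C(\bm{x}-\bm{x}')$ is the covariance function of a second-order zero-mean random field on $\mathbb{R}^d$, i.e. is (symmetric) positive semidefinite: $\sum_{i,j=1}^n v_iv_jC(\bm{x}_i-\bm{x}_j)\ge 0$ for all $n\in\mathbb{N}$, $v_1,\dots,v_n\in\mathbb{R}$, $\bm{x}_1,\dots,\bm{x}_n\in\mathbb{R}^d$. The class $\Phi_d$ is the set of continuous functions $\varphi:[0,\infty)\to\mathbb{R}$ such that $(\bm{x},\bm{x}')\mapsto\varphi(\|\bm{x}-\bm{x}'\|)$ is positive semidefinite on $\mathbb{R}^d\times\mathbb{R}^d$ ($\|\cdot\|$ is the Euclidean norm). "Twice differentiable at the origin" refers to the even extension $t\mapsto\varphi_2(|t|)$, $t\in\mathbb{R}$. At $\bm{h}=\bm{0}$ the bracketed expression is understood by continuity, i.e. as $\varphi_2''(0)$. *)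

theory Defs
  imports "HOL-Analysis.Analysis"
begin

definition psd_kernel :: "('a \<Rightarrow> 'a \<Rightarrow> real) \<Rightarrow> bool" where
  "psd_kernel K \<longleftrightarrow>
     (\<forall>x y. K x y = K y x) \<and>
     (\<forall>(n::nat) (v :: nat \<Rightarrow> real) (x :: nat \<Rightarrow> 'a).
        0 \<le> (\<Sum>i<n. \<Sum>j<n. v i * v j * K (x i) (x j)))"

definition stationary_covariance :: "(real ^ 'd \<Rightarrow> real) \<Rightarrow> bool" where
  "stationary_covariance C \<longleftrightarrow> psd_kernel (\<lambda>x y. C (x - y))"

text \<open>The class \<open>\<Phi>\<^sub>d\<close>, with \<open>d = CARD('d)\<close>. A function on \<open>[0, \<infinity>)\<close> is represented by
  a function on the reals, whose values at negative arguments are irrelevant.\<close>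

definition Phi :: "'d::finite itself \<Rightarrow> (real \<Rightarrow> real) set" where
  "Phi _ = {\<phi>. continuous_on {0..} \<phi> \<and>
               psd_kernel (\<lambda>(x :: real ^ 'd) y. \<phi> (norm (x - y)))}"

definition even_ext :: "(real \<Rightarrow> real) \<Rightarrow> real \<Rightarrow> real" where
  "even_ext \<phi> = (\<lambda>t. \<phi> \<bar>t\<bar>)"

definition twice_differentiable_at :: "(real \<Rightarrow> real) \<Rightarrow> real \<Rightarrow> bool" where
  "twice_differentiable_at f t \<longleftrightarrow>
     (\<forall>\<^sub>F s in nhds t. f differentiable (at s)) \<and> deriv f differentiable (at t)"

text \<open>The first and second derivatives \<open>\<phi>'\<close> and \<open>\<phi>''\<close> on \<open>[0, \<infinity>)\<close>, taken for the even extension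
  so that they also make sense at the origin; at \<open>t > 0\<close> they are the usual derivatives of \<open>\<phi>\<close>.
  For members of \<open>\<Phi>\<^sub>d\<close>, twice differentiability at the origin implies that both exist everywhere,
  so the arbitrary value of \<^const>\<open>deriv\<close> at points of non-differentiability plays no role.\<close>

definition phi_d1 :: "(real \<Rightarrow> real) \<Rightarrow> real \<Rightarrow> real" where
  "phi_d1 \<phi> = deriv (even_ext \<phi>)"

definition phi_d2 :: "(real \<Rightarrow> real) \<Rightarrow> real \<Rightarrow> real" where
  "phi_d2 \<phi> = deriv (deriv (even_ext \<phi>))"

text \<open>Only meaningful for nonzero arguments.\<close>

definition vec_angle :: "real ^ 'd \<Rightarrow> real ^ 'd \<Rightarrow> real" where
  "vec_angle x y = arccos ((x \<bullet> y) / (norm x * norm y))"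

text \<open>The bracketed expression with parameter \<open>a\<close>; at \<open>h = 0\<close> it is defined by continuity.\<close>

definition bracket :: "(real \<Rightarrow> real) \<Rightarrow> real \<Rightarrow> real ^ 'd \<Rightarrow> real ^ 'd \<Rightarrow> real" where
  "bracket \<phi> a u h =
     (if h = 0 then phi_d2 \<phi> 0
      else (cos (vec_angle h u))\<^sup>2 * phi_d2 \<phi> (sqrt a * norm h)
         + (sin (vec_angle h u))\<^sup>2 * (phi_d1 \<phi> (sqrt a * norm h) / (sqrt a * norm h)))"

end

theory Submission
  imports Defs
begin

text \<open>Write \<open>f\<close> for the even extension of \<open>\<phi>2\<close> and \<open>C h = f (sqrt a2 * norm h)\<close>, a stationary
  covariance. By the chain rule, \<open>a2\<close> times the bracket is the second derivative of \<open>C\<close> along \<open>u\<close>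
  (\<open>second_diff_tendsto_bracket\<close>), and minus that derivative is the covariance of the derivative
  in direction \<open>u\<close> of a random field with covariance \<open>C\<close>. The difference quotient of the field along \<open>u\<close> with step \<open>e\<close>
  has covariance \<open>(2 * C h - C (h + e u) - C (h - e u)) / e\<^sup>2\<close>, so this function is positive
  semidefinite (\<open>psd_kernel_second_diff\<close>), and positive semidefiniteness survives the pointwise
  limit \<open>e \<rightarrow> 0\<close>.

  The limit can be computed only where \<open>f\<close> is twice differentiable, which is assumed at the origin
  alone; propagating it to the whole line (\<open>differentiable_everywhere\<close> and
  \<open>deriv_differentiable_everywhere\<close>) is the analytic core. A positive semidefinite kernel is a Gram
  matrix, here accessed through the semi-inner product \<open>kernel_form\<close> on formal linear combinations
  of points. The difference quotients \<open>\<mu> e = (\<delta> (t + e) - \<delta> t) / e\<close> of point evaluations have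
  inner products that are double difference quotients of \<open>f\<close> at the origin; by the mean value
  theorem these all tend to the same number \<open>- f'' 0\<close>, so \<open>\<mu>\<close> is Cauchy as \<open>e \<rightarrow> 0\<close>, uniformly
  in \<open>t\<close>. By the Cauchy--Schwarz inequality its inner product with a fixed vector, or with
  vectors of bounded norm, is Cauchy too. Pairing with \<open>\<delta> 0\<close> gives \<open>f'\<close> at \<open>t\<close>; pairing with
  difference quotients at \<open>0\<close> gives \<open>f''\<close> at \<open>t\<close>.\<close>

section \<open>The semi-inner product of a positive semidefinite kernel\<close>

text \<open>A list of pairs \<open>(v, x)\<close> stands for the formal linear combination of the points \<open>x\<close> with
  weights \<open>v\<close>; lists make sums and translates of such combinations easy to write down.\<close>

definition kernel_form :: "('a \<Rightarrow> 'a \<Rightarrow> real) \<Rightarrow> (real \<times> 'a) list \<Rightarrow> (real \<times> 'a) list \<Rightarrow> real" where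
  "kernel_form K xs ys = (\<Sum>p\<leftarrow>xs. \<Sum>q\<leftarrow>ys. fst p * fst q * K (snd p) (snd q))"

definition scale_comb :: "real \<Rightarrow> (real \<times> 'a) list \<Rightarrow> (real \<times> 'a) list" where
  "scale_comb c xs = map (\<lambda>p. (c * fst p, snd p)) xs"

lemma kernel_form_append_left: "kernel_form K (xs @ ys) zs = kernel_form K xs zs + kernel_form K ys zs"
  by (simp add: kernel_form_def)

lemma kernel_form_append_right: "kernel_form K zs (xs @ ys) = kernel_form K zs xs + kernel_form K zs ys"
  by (simp add: kernel_form_def sum_list_addf)

lemma kernel_form_scale_left: "kernel_form K (scale_comb c xs) zs = c * kernel_form K xs zs"
  by (simp add: kernel_form_def scale_comb_def o_def sum_list_const_mult[symmetric] mult.assoc)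

lemma kernel_form_scale_right: "kernel_form K zs (scale_comb c xs) = c * kernel_form K zs xs"
  by (simp add: kernel_form_def scale_comb_def o_def sum_list_const_mult[symmetric] mult_ac)

lemmas kernel_form_linear = kernel_form_append_left kernel_form_append_right
  kernel_form_scale_left kernel_form_scale_right

lemma kernel_form_conv_sum:
  "kernel_form K xs ys = (\<Sum>i<length xs. \<Sum>j<length ys.
     fst (xs ! i) * fst (ys ! j) * K (snd (xs ! i)) (snd (ys ! j)))"
  by (simp add: kernel_form_def sum_list_sum_nth atLeast0LessThan)

lemma kernel_form_nonneg:
  assumes "psd_kernel K"
  shows "0 \<le> kernel_form K xs xs"
proof -
  have "0 \<le> (\<Sum>i<n. \<Sum>j<n. v i * v j * K (x i) (x j))" for n and v :: "nat \<Rightarrow> real" and x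
    using assms by (simp add: psd_kernel_def)
  from this[where n = "length xs" and v = "\<lambda>i. fst (xs ! i)" and x = "\<lambda>i. snd (xs ! i)"]
  show ?thesis by (simp add: kernel_form_conv_sum)
qed

lemma kernel_form_commute:
  assumes "psd_kernel K"
  shows "kernel_form K xs ys = kernel_form K ys xs"
proof -
  have "K x y = K y x" for x y using assms by (simp add: psd_kernel_def)
  then have "fst (xs ! i) * fst (ys ! j) * K (snd (xs ! i)) (snd (ys ! j))
      = fst (ys ! j) * fst (xs ! i) * K (snd (ys ! j)) (snd (xs ! i))" for i j
    by (metis mult.commute)
  then show ?thesis
    unfolding kernel_form_conv_sum by (subst sum.swap) (intro sum.cong refl)
qed

lemma kernel_form_Cauchy_Schwarz:
  assumes "psd_kernel K"
  shows "(kernel_form K xs ys)\<^sup>2 \<le> kernel_form K xs xs * kernel_form K ys ys"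
proof -
  define A B P where "A = kernel_form K xs xs" and "B = kernel_form K ys ys"
    and "P = kernel_form K xs ys"
  have nonneg: "0 \<le> A + 2 * t * P + t\<^sup>2 * B" for t
    using kernel_form_nonneg[OF assms, of "xs @ scale_comb t ys"]
      kernel_form_commute[OF assms, of ys xs]
    by (simp add: kernel_form_linear A_def B_def P_def algebra_simps power2_eq_square)
  have "B \<ge> 0" unfolding B_def by (rule kernel_form_nonneg[OF assms])
  show ?thesis
  proof (cases "B = 0")
    case True
    have "P = 0"
    proof (rule ccontr)
      assume "P \<noteq> 0"
      then show False using nonneg[of "- (A + 1) / (2 * P)"] True by (simp add: field_simps)
    qed
    then show ?thesis using True by (simp add: P_def B_def)
  next
    case False
    with \<open>B \<ge> 0\<close> have "B > 0" by simp
    then have "0 \<le> A - P\<^sup>2 / B"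
      using nonneg[of "- P / B"] by (simp add: field_simps power2_eq_square)
    then show ?thesis using \<open>B > 0\<close> by (simp add: field_simps P_def A_def B_def)
  qed
qed

section \<open>Closure properties of positive semidefinite kernels\<close>

lemma psd_kernel_comp:
  assumes "psd_kernel K"
  shows "psd_kernel (\<lambda>x y. K (g x) (g y))"
  unfolding psd_kernel_def
proof (intro conjI allI)
  show "K (g x) (g y) = K (g y) (g x)" for x y
    using assms unfolding psd_kernel_def by blast
  have "0 \<le> (\<Sum>i<n. \<Sum>j<n. v i * v j * K (z i) (z j))" for n :: nat and v z
    using assms unfolding psd_kernel_def by blast
  then show "0 \<le> (\<Sum>i<n. \<Sum>j<n. v i * v j * K (g (x i)) (g (x j)))" for n :: nat and v x .
qed

lemma psd_kernel_add:
  assumes "psd_kernel K" "psd_kernel L"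
  shows "psd_kernel (\<lambda>x y. K x y + L x y)"
  using assms unfolding psd_kernel_def by (simp add: distrib_left sum.distrib)

lemma psd_kernel_scale:
  assumes "psd_kernel K" "c \<ge> 0"
  shows "psd_kernel (\<lambda>x y. c * K x y)"
proof -
  have "(\<Sum>i<n. \<Sum>j<n. v i * v j * (c * K (x i) (x j)))
      = c * (\<Sum>i<n. \<Sum>j<n. v i * v j * K (x i) (x j))" for n :: nat and v x
    by (simp add: sum_distrib_left mult_ac)
  then show ?thesis using assms unfolding psd_kernel_def by simp
qed

lemma psd_kernel_limit:
  assumes psd: "\<forall>\<^sub>F e in F. psd_kernel (K e)" and "F \<noteq> bot"
    and lim: "\<And>x y. ((\<lambda>e. K e x y) \<longlongrightarrow> L x y) F"
  shows "psd_kernel L"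
  unfolding psd_kernel_def
proof (intro conjI allI)
  fix x y
  have "\<forall>\<^sub>F e in F. K e x y = K e y x"
    using psd by eventually_elim (simp add: psd_kernel_def)
  then have "((\<lambda>e. K e x y) \<longlongrightarrow> L y x) F"
    using lim[of y x] by (simp add: tendsto_cong)
  then show "L x y = L y x" using tendsto_unique[OF \<open>F \<noteq> bot\<close> lim] by blast
next
  fix n :: nat and v x
  have "((\<lambda>e. \<Sum>i<n. \<Sum>j<n. v i * v j * K e (x i) (x j))
      \<longlongrightarrow> (\<Sum>i<n. \<Sum>j<n. v i * v j * L (x i) (x j))) F"
    by (intro tendsto_intros lim)
  moreover have "\<forall>\<^sub>F e in F. 0 \<le> (\<Sum>i<n. \<Sum>j<n. v i * v j * K e (x i) (x j))"
    using psd by eventually_elim (simp add: psd_kernel_def)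
  ultimately show "0 \<le> (\<Sum>i<n. \<Sum>j<n. v i * v j * L (x i) (x j))"
    by (intro tendsto_lowerbound[OF _ _ \<open>F \<noteq> bot\<close>])
qed

text \<open>The covariance of the increments \<open>Z (x + w) - Z x\<close> of a random field \<open>Z\<close> with covariance
  \<open>C\<close>: evaluate the form of \<open>C\<close> at the combination with weight \<open>v i\<close> at \<open>x i + w\<close> and \<open>- v i\<close>
  at \<open>x i\<close>.\<close>

lemma psd_kernel_second_diff:
  fixes C :: "'a::real_vector \<Rightarrow> real"
  assumes psd: "psd_kernel (\<lambda>x y. C (x - y))"
  shows "psd_kernel (\<lambda>x y. 2 * C (x - y) - C (x - y + w) - C (x - y - w))"
  unfolding psd_kernel_def
proof (intro conjI allI)
  fix x y
  have even: "C (p - q) = C (q - p)" for p q using psd by (simp add: psd_kernel_def)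
  have "C (x - y + w) = C (y - x - w)" "C (x - y - w) = C (y - x + w)"
    using even[of "x + w" y] even[of x "y + w"] by (simp_all add: algebra_simps)
  then show "2 * C (x - y) - C (x - y + w) - C (x - y - w)
      = 2 * C (y - x) - C (y - x + w) - C (y - x - w)"
    using even[of x y] by simp
next
  fix n :: nat and v :: "nat \<Rightarrow> real" and x :: "nat \<Rightarrow> 'a"
  define xs where "xs = map (\<lambda>i. (v i, x i + w)) [0..<n] @ map (\<lambda>i. (- v i, x i)) [0..<n]"
  have "kernel_form (\<lambda>x y. C (x - y)) xs xs =
      (\<Sum>i<n. \<Sum>j<n. v i * v j *
        (C (x i - x j) + C (x i - x j) - C (x i - x j + w) - C (x i - x j - w)))"
    by (simp add: xs_def kernel_form_def o_def interv_sum_list_conv_sum_set_nat atLeast0LessThan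
        sum.distrib sum_negf sum_subtractf algebra_simps)
      (simp add: sum_distrib_left mult_ac)
  then show "0 \<le> (\<Sum>i<n. \<Sum>j<n.
      v i * v j * (2 * C (x i - x j) - C (x i - x j + w) - C (x i - x j - w)))"
    using kernel_form_nonneg[OF psd, of xs] by (simp only: mult_2)
qed

section \<open>Double difference quotients\<close>

definition double_quotient :: "(real \<Rightarrow> real) \<Rightarrow> real \<Rightarrow> real \<Rightarrow> real \<Rightarrow> real" where
  "double_quotient f t e d = (f (t + e - d) - f (t + e) - f (t - d) + f t) / (e * d)"

text \<open>By the mean value theorem in the step \<open>e\<close>, the double quotient is
  \<open>(f' (x - d) - f' x) / d\<close> with \<open>x\<close> between \<open>t\<close> and \<open>t + e\<close>. The error of the linear
  approximation of \<open>f'\<close> near \<open>t\<close> is small relative to \<open>\<bar>e\<bar> + \<bar>d\<bar>\<close>, hence relative to \<open>\<bar>d\<bar>\<close>, because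
  \<open>d\<close> is the larger step.\<close>

lemma double_quotient_bound:
  fixes f :: "real \<Rightarrow> real"
  assumes ev: "\<forall>\<^sub>F s in nhds t. f differentiable (at s)"
    and der: "(deriv f has_real_derivative c) (at t)"
    and "k > 0"
  shows "\<exists>\<delta>>0. \<forall>e d. 0 < \<bar>e\<bar> \<longrightarrow> \<bar>e\<bar> \<le> \<bar>d\<bar> \<longrightarrow> \<bar>d\<bar> < \<delta> \<longrightarrow> \<bar>double_quotient f t e d + c\<bar> \<le> k"
proof -
  obtain r where r: "r > 0" "\<And>s. dist s t < r \<Longrightarrow> f differentiable (at s)"
    using ev unfolding eventually_nhds_metric by blast
  have "((\<lambda>h. (deriv f (t + h) - deriv f t) / h) \<longlongrightarrow> c) (at 0)"
    using der by (simp add: DERIV_def)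
  then obtain r' where r': "r' > 0"
    "\<And>h. h \<noteq> 0 \<Longrightarrow> \<bar>h\<bar> < r' \<Longrightarrow> \<bar>(deriv f (t + h) - deriv f t) / h - c\<bar> < k / 3"
    using LIM_D[of "\<lambda>h. (deriv f (t + h) - deriv f t) / h" c 0 "k / 3"] \<open>k > 0\<close> by auto
  have lin: "\<bar>deriv f (t + h) - deriv f t - c * h\<bar> \<le> k / 3 * \<bar>h\<bar>" if "\<bar>h\<bar> < r'" for h
  proof (cases "h = 0")
    case False
    have "\<bar>deriv f (t + h) - deriv f t - c * h\<bar> = \<bar>(deriv f (t + h) - deriv f t) / h - c\<bar> * \<bar>h\<bar>"
      unfolding abs_mult[symmetric] left_diff_distrib using False by simp
    also have "\<dots> \<le> k / 3 * \<bar>h\<bar>"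
      using r'(2)[OF False that] by (intro mult_right_mono) auto
    finally show ?thesis .
  qed simp
  define \<delta> where "\<delta> = min r r' / 2"
  have "\<delta> > 0" using r r' by (simp add: \<delta>_def)
  moreover have "\<bar>double_quotient f t e d + c\<bar> \<le> k" if "0 < \<bar>e\<bar>" "\<bar>e\<bar> \<le> \<bar>d\<bar>" "\<bar>d\<bar> < \<delta>" for e d
  proof -
    define g where "g s = f (t + s - d) - f (t + s)" for s
    have f': "(f has_real_derivative deriv f s) (at s)" if "\<bar>s - t\<bar> < r" for s
      using r(2)[of s] that by (simp add: dist_real_def DERIV_deriv_iff_real_differentiable)
    have g': "(g has_real_derivative deriv f (t + s - d) - deriv f (t + s)) (at s)"
      if "\<bar>s\<bar> \<le> \<bar>e\<bar>" for s
    proof -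
      have "((\<lambda>s. f (t + s - d)) has_real_derivative deriv f (t + s - d) * 1) (at s)"
        using that \<open>\<bar>e\<bar> \<le> \<bar>d\<bar>\<close> \<open>\<bar>d\<bar> < \<delta>\<close>
        by (intro DERIV_chain2[where f = f] f') (auto intro!: derivative_eq_intros simp: \<delta>_def)
      moreover have "((\<lambda>s. f (t + s)) has_real_derivative deriv f (t + s) * 1) (at s)"
        using that \<open>\<bar>e\<bar> \<le> \<bar>d\<bar>\<close> \<open>\<bar>d\<bar> < \<delta>\<close>
        by (intro DERIV_chain2[where f = f] f') (auto intro!: derivative_eq_intros simp: \<delta>_def)
      ultimately show ?thesis unfolding g_def using DERIV_diff by fastforce
    qed
    obtain x where x: "\<bar>x\<bar> \<le> \<bar>e\<bar>" "g e - g 0 = e * (deriv f (t + x - d) - deriv f (t + x))"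
    proof (cases "e > 0")
      case True
      from MVT2[OF this, of g "\<lambda>s. deriv f (t + s - d) - deriv f (t + s)"] g' True
      obtain z where "z > 0" "z < e"
        "g e - g 0 = (e - 0) * (deriv f (t + z - d) - deriv f (t + z))" by auto
      then show ?thesis using that[of z] by auto
    next
      case False
      then have "e < 0" using \<open>0 < \<bar>e\<bar>\<close> by auto
      from MVT2[OF this, of g "\<lambda>s. deriv f (t + s - d) - deriv f (t + s)"] g' this
      obtain z where "z > e" "z < 0"
        "g 0 - g e = (0 - e) * (deriv f (t + z - d) - deriv f (t + z))" by auto
      then show ?thesis using that[of z] by (auto simp: algebra_simps)
    qed
    have nz: "e \<noteq> 0" "d \<noteq> 0" using that by auto
    have "double_quotient f t e d = (g e - g 0) / (e * d)"
      by (simp add: double_quotient_def g_def)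
    also have "\<dots> = (deriv f (t + x - d) - deriv f (t + x)) / d"
      using nz by (simp add: x(2))
    finally have "double_quotient f t e d + c
        = ((deriv f (t + (x - d)) - deriv f t - c * (x - d)) - (deriv f (t + x) - deriv f t - c * x)) / d"
      (is "_ = (?A - ?B) / d")
      using nz by (simp add: field_simps)
    then have "\<bar>double_quotient f t e d + c\<bar> * \<bar>d\<bar> = \<bar>?A - ?B\<bar>"
      using nz by (simp only: abs_divide) simp
    also have "\<dots> \<le> \<bar>?A\<bar> + \<bar>?B\<bar>"
      by (rule abs_triangle_ineq4)
    also have "\<dots> \<le> k / 3 * \<bar>x - d\<bar> + k / 3 * \<bar>x\<bar>"
      using x(1) that by (intro add_mono lin) (auto simp: \<delta>_def)
    also have "\<dots> \<le> k * \<bar>d\<bar>"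
    proof -
      have "k / 3 * (\<bar>x - d\<bar> + \<bar>x\<bar>) \<le> k / 3 * (3 * \<bar>d\<bar>)"
        using x(1) that \<open>k > 0\<close> by (intro mult_left_mono) auto
      then show ?thesis by (simp add: algebra_simps)
    qed
    finally show ?thesis using nz by simp
  qed
  ultimately show ?thesis by blast
qed

text \<open>For even \<open>f\<close> the double quotient at the origin is symmetric in the two steps, so no
  relation between their sizes is required.\<close>

lemma double_quotient_bound_even:
  fixes f :: "real \<Rightarrow> real"
  assumes even: "\<And>s. f (- s) = f s"
    and ev: "\<forall>\<^sub>F s in nhds 0. f differentiable (at s)"
    and der: "(deriv f has_real_derivative c) (at 0)"
    and "k > 0"
  shows "\<exists>\<delta>>0. \<forall>e d. e \<noteq> 0 \<longrightarrow> d \<noteq> 0 \<longrightarrow> \<bar>e\<bar> < \<delta> \<longrightarrow> \<bar>d\<bar> < \<delta> \<longrightarrow> \<bar>double_quotient f 0 e d + c\<bar> \<le> k"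
proof -
  obtain \<delta> where \<delta>: "\<delta> > 0"
    "\<And>e d. 0 < \<bar>e\<bar> \<Longrightarrow> \<bar>e\<bar> \<le> \<bar>d\<bar> \<Longrightarrow> \<bar>d\<bar> < \<delta> \<Longrightarrow> \<bar>double_quotient f 0 e d + c\<bar> \<le> k"
    using double_quotient_bound[OF ev der \<open>k > 0\<close>] by blast
  have "double_quotient f 0 e d = double_quotient f 0 d e" for e d
    using even[of "e - d"] even[of e] even[of d] by (simp add: double_quotient_def mult.commute)
  then have "\<bar>double_quotient f 0 e d + c\<bar> \<le> k" if "e \<noteq> 0" "d \<noteq> 0" "\<bar>e\<bar> < \<delta>" "\<bar>d\<bar> < \<delta>" for e d
    using \<delta>(2)[of e d] \<delta>(2)[of d e] that by (cases "\<bar>e\<bar> \<le> \<bar>d\<bar>") auto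
  then show ?thesis using \<delta>(1) by blast
qed

lemma second_diff_tendsto:
  fixes g :: "real \<Rightarrow> real"
  assumes "\<forall>\<^sub>F s in nhds 0. g differentiable (at s)"
    and "(deriv g has_real_derivative c) (at 0)"
  shows "((\<lambda>e. (2 * g 0 - g e - g (- e)) / e\<^sup>2) \<longlongrightarrow> - c) (at 0)"
proof (rule LIM_I)
  fix k :: real assume "k > 0"
  then obtain \<delta> where \<delta>: "\<delta> > 0"
    "\<And>e d. 0 < \<bar>e\<bar> \<Longrightarrow> \<bar>e\<bar> \<le> \<bar>d\<bar> \<Longrightarrow> \<bar>d\<bar> < \<delta> \<Longrightarrow> \<bar>double_quotient g 0 e d + c\<bar> \<le> k / 2"
    using double_quotient_bound[OF assms, of "k / 2"] by auto
  have "norm ((2 * g 0 - g e - g (- e)) / e\<^sup>2 - - c) < k" if "e \<noteq> 0" "norm (e - 0) < \<delta>" for e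
    using \<delta>(2)[of e e] that \<open>k > 0\<close> by (simp add: double_quotient_def power2_eq_square algebra_simps)
  then show "\<exists>s>0. \<forall>e. e \<noteq> 0 \<and> norm (e - 0) < s \<longrightarrow>
      norm ((2 * g 0 - g e - g (- e)) / e\<^sup>2 - - c) < k"
    using \<delta>(1) by blast
qed

section \<open>Twice differentiability spreads from the origin\<close>

lemma Cauchy_at_imp_convergent:
  fixes q :: "real \<Rightarrow> real"
  assumes "\<And>k. k > 0 \<Longrightarrow> \<exists>\<delta>>0. \<forall>e d. e \<noteq> 0 \<longrightarrow> d \<noteq> 0 \<longrightarrow> \<bar>e\<bar> < \<delta> \<longrightarrow> \<bar>d\<bar> < \<delta> \<longrightarrow> \<bar>q e - q d\<bar> \<le> k"
  shows "\<exists>L. (q \<longlongrightarrow> L) (at 0)"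
proof -
  have "cauchy_filter (filtermap q (at 0))"
    unfolding cauchy_filter_metric_filtermap
  proof (intro allI impI)
    fix k :: real assume "k > 0"
    then obtain \<delta> where \<delta>: "\<delta> > 0"
      "\<And>e d. e \<noteq> 0 \<Longrightarrow> d \<noteq> 0 \<Longrightarrow> \<bar>e\<bar> < \<delta> \<Longrightarrow> \<bar>d\<bar> < \<delta> \<Longrightarrow> \<bar>q e - q d\<bar> \<le> k / 2"
      using assms[of "k / 2"] by auto
    have "\<forall>\<^sub>F e in at 0. e \<noteq> 0 \<and> \<bar>e\<bar> < \<delta>"
      unfolding eventually_at using \<delta>(1) by (auto simp: dist_real_def)
    moreover have "dist (q e) (q d) < k" if "e \<noteq> 0 \<and> \<bar>e\<bar> < \<delta>" "d \<noteq> 0 \<and> \<bar>d\<bar> < \<delta>" for e d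
      using \<delta>(2)[of e d] that \<open>k > 0\<close> by (simp add: dist_real_def)
    ultimately show "\<exists>P. eventually P (at 0) \<and> (\<forall>e d. P e \<and> P d \<longrightarrow> dist (q e) (q d) < k)"
      by (intro exI[of _ "\<lambda>e. e \<noteq> 0 \<and> \<bar>e\<bar> < \<delta>"]) blast
  qed
  then show ?thesis
    using cauchy_filter_complete_converges[OF _ complete_UNIV, of "filtermap q (at 0)"]
    by (auto simp: filterlim_def filtermap_bot_iff)
qed

definition quotient_comb :: "real \<Rightarrow> real \<Rightarrow> (real \<times> real) list" where
  "quotient_comb t e = [(1 / e, t + e), (- 1 / e, t)]"

locale smooth_at_origin =
  fixes f :: "real \<Rightarrow> real" and c :: real
  assumes psd: "psd_kernel (\<lambda>s t. f (s - t))"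
    and differentiable_near_0: "\<forall>\<^sub>F s in nhds 0. f differentiable (at s)"
    and second_deriv_0: "(deriv f has_real_derivative c) (at 0)"
begin

abbreviation form :: "(real \<times> real) list \<Rightarrow> (real \<times> real) list \<Rightarrow> real" where
  "form \<equiv> kernel_form (\<lambda>s t. f (s - t))"

abbreviation comb_diff :: "real \<Rightarrow> real \<Rightarrow> real \<Rightarrow> (real \<times> real) list" where
  "comb_diff t e d \<equiv> quotient_comb t e @ scale_comb (- 1) (quotient_comb t d)"

lemma f_even: "f (- s) = f s"
proof -
  have "f (0 - s) = f (s - 0)" using psd unfolding psd_kernel_def by blast
  then show ?thesis by simp
qed

lemma form_quotient_comb:
  "form (quotient_comb s e) (quotient_comb t d) = double_quotient f (s - t) e d"
  by (simp add: kernel_form_def quotient_comb_def double_quotient_def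
      diff_divide_distrib add_divide_distrib algebra_simps)

lemma form_quotient_comb_near:
  assumes "k > 0"
  shows "\<exists>\<delta>>0. \<forall>t e d. e \<noteq> 0 \<longrightarrow> d \<noteq> 0 \<longrightarrow> \<bar>e\<bar> < \<delta> \<longrightarrow> \<bar>d\<bar> < \<delta> \<longrightarrow>
           \<bar>form (quotient_comb t e) (quotient_comb t d) + c\<bar> \<le> k"
  using double_quotient_bound_even[OF f_even differentiable_near_0 second_deriv_0 assms]
  by (simp add: form_quotient_comb)

text \<open>The squared distance of two difference quotients expands into four inner products, all of
  them close to \<open>- c\<close>, which occurs with total weight \<open>0\<close>.\<close>

lemma comb_diff_small:
  assumes "k > 0"
  shows "\<exists>\<delta>>0. \<forall>t e d. e \<noteq> 0 \<longrightarrow> d \<noteq> 0 \<longrightarrow> \<bar>e\<bar> < \<delta> \<longrightarrow> \<bar>d\<bar> < \<delta> \<longrightarrow>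
           form (comb_diff t e d) (comb_diff t e d) \<le> k"
proof -
  obtain \<delta> where \<delta>: "\<delta> > 0" "\<And>t e d. e \<noteq> 0 \<Longrightarrow> d \<noteq> 0 \<Longrightarrow> \<bar>e\<bar> < \<delta> \<Longrightarrow> \<bar>d\<bar> < \<delta> \<Longrightarrow>
      \<bar>form (quotient_comb t e) (quotient_comb t d) + c\<bar> \<le> k / 4"
    using form_quotient_comb_near[of "k / 4"] assms by auto
  have "form (comb_diff t e d) (comb_diff t e d) \<le> k"
    if "e \<noteq> 0" "d \<noteq> 0" "\<bar>e\<bar> < \<delta>" "\<bar>d\<bar> < \<delta>" for t e d
    using \<delta>(2)[of e e t] \<delta>(2)[of e d t] \<delta>(2)[of d e t] \<delta>(2)[of d d t] that
    unfolding kernel_form_linear abs_le_iff by auto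
  then show ?thesis using \<delta>(1) by blast
qed

text \<open>Cauchy--Schwarz in the form in which both derivatives use it: pairing with combinations of
  squared norm at most \<open>M\<close> turns the Cauchy property of the difference quotients into that of
  real numbers.\<close>

lemma pairing_small:
  assumes "k > 0" "M > 0"
  shows "\<exists>\<delta>>0. \<forall>t e d ys. e \<noteq> 0 \<longrightarrow> d \<noteq> 0 \<longrightarrow> \<bar>e\<bar> < \<delta> \<longrightarrow> \<bar>d\<bar> < \<delta> \<longrightarrow> form ys ys \<le> M \<longrightarrow>
           \<bar>form (quotient_comb t e) ys - form (quotient_comb t d) ys\<bar> \<le> k"
proof -
  obtain \<delta> where \<delta>: "\<delta> > 0" "\<And>t e d. e \<noteq> 0 \<Longrightarrow> d \<noteq> 0 \<Longrightarrow> \<bar>e\<bar> < \<delta> \<Longrightarrow> \<bar>d\<bar> < \<delta> \<Longrightarrow>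
      form (comb_diff t e d) (comb_diff t e d) \<le> k\<^sup>2 / M"
    using comb_diff_small[of "k\<^sup>2 / M"] assms by auto
  have "\<bar>form (quotient_comb t e) ys - form (quotient_comb t d) ys\<bar> \<le> k"
    if "e \<noteq> 0" "d \<noteq> 0" "\<bar>e\<bar> < \<delta>" "\<bar>d\<bar> < \<delta>" "form ys ys \<le> M" for t e d ys
  proof -
    have "(form (comb_diff t e d) ys)\<^sup>2
        \<le> form (comb_diff t e d) (comb_diff t e d) * form ys ys"
      by (rule kernel_form_Cauchy_Schwarz[OF psd])
    also have "\<dots> \<le> k\<^sup>2 / M * M"
      using \<delta>(2)[OF that(1-4)] that(5) kernel_form_nonneg[OF psd] assms
      by (intro mult_mono) auto
    also have "\<dots> = k\<^sup>2" using assms by simp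
    finally have "\<bar>form (comb_diff t e d) ys\<bar> \<le> k"
      using assms(1) abs_le_square_iff[of "form (comb_diff t e d) ys" k] by simp
    then show ?thesis by (simp add: kernel_form_linear)
  qed
  then show ?thesis using \<delta>(1) by blast
qed

lemma differentiable_everywhere: "f differentiable (at t)"
proof -
  have quot: "form (quotient_comb t e) [(1, 0)] = (f (t + e) - f t) / e" for e
    by (simp add: kernel_form_def quotient_comb_def diff_divide_distrib)
  have norm: "form [(1, 0)] [(1, 0)] \<le> \<bar>f 0\<bar> + 1"
    by (simp add: kernel_form_def)
  have "\<exists>L. ((\<lambda>e. form (quotient_comb t e) [(1, 0)]) \<longlongrightarrow> L) (at 0)"
  proof (rule Cauchy_at_imp_convergent)
    fix k :: real assume "k > 0"
    have "\<bar>f 0\<bar> + 1 > 0" by simp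
    from pairing_small[OF \<open>k > 0\<close> this] norm
    show "\<exists>\<delta>>0. \<forall>e d. e \<noteq> 0 \<longrightarrow> d \<noteq> 0 \<longrightarrow> \<bar>e\<bar> < \<delta> \<longrightarrow> \<bar>d\<bar> < \<delta> \<longrightarrow>
        \<bar>form (quotient_comb t e) [(1, 0)] - form (quotient_comb t d) [(1, 0)]\<bar> \<le> k"
      by blast
  qed
  then show ?thesis
    unfolding quot real_differentiable_def DERIV_def .
qed

text \<open>The difference quotients of \<open>f'\<close> are limits of pairings with difference quotients at the
  origin, whose squared norm tends to \<open>- c\<close> and is therefore bounded.\<close>

lemma deriv_differentiable_everywhere: "deriv f differentiable (at t)"
proof -
  have f': "(f has_real_derivative deriv f s) (at s)" for s
    using differentiable_everywhere by (simp add: DERIV_deriv_iff_real_differentiable)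
  have left_quot: "((\<lambda>x. (f (s - x) - f s) / x) \<longlongrightarrow> - deriv f s) (at 0)" for s
  proof -
    have "((\<lambda>x. f (s - x)) has_real_derivative deriv f (s - 0) * - 1) (at 0)"
      by (intro DERIV_chain2[where f = f] f') (auto intro!: derivative_eq_intros)
    then show ?thesis by (simp add: DERIV_def)
  qed
  define r where "r e = (deriv f (t + e) - deriv f t) / e" for e
  have lim: "((\<lambda>x. form (quotient_comb t e) (quotient_comb 0 x)) \<longlongrightarrow> - r e) (at 0)" for e
  proof -
    have "((\<lambda>x. ((f (t + e - x) - f (t + e)) / x - (f (t - x) - f t) / x) / e) \<longlongrightarrow>
        (- deriv f (t + e) - - deriv f t) / e) (at 0)"
    proof (cases "e = 0")
      case False
      then show ?thesis by (intro tendsto_divide tendsto_diff left_quot tendsto_const)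
    qed simp
    moreover have "(- deriv f (t + e) - - deriv f t) / e = - r e"
      by (simp add: r_def divide_simps)
    moreover have "((f (t + e - x) - f (t + e)) / x - (f (t - x) - f t) / x) / e
        = form (quotient_comb t e) (quotient_comb 0 x)" for x
      unfolding form_quotient_comb double_quotient_def
      by (simp add: diff_divide_distrib[symmetric] algebra_simps)
    ultimately show ?thesis by simp
  qed
  obtain \<delta>0 where \<delta>0: "\<delta>0 > 0" "\<And>e d. e \<noteq> 0 \<Longrightarrow> d \<noteq> 0 \<Longrightarrow> \<bar>e\<bar> < \<delta>0 \<Longrightarrow> \<bar>d\<bar> < \<delta>0 \<Longrightarrow>
      \<bar>form (quotient_comb 0 e) (quotient_comb 0 d) + c\<bar> \<le> 1"
    using form_quotient_comb_near[of 1] by auto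
  have norm: "\<forall>\<^sub>F x in at 0. form (quotient_comb 0 x) (quotient_comb 0 x) \<le> \<bar>c\<bar> + 1"
    unfolding eventually_at
  proof (intro exI[of _ \<delta>0] conjI ballI impI)
    fix x :: real assume "x \<noteq> 0 \<and> dist x 0 < \<delta>0"
    then show "form (quotient_comb 0 x) (quotient_comb 0 x) \<le> \<bar>c\<bar> + 1"
      using \<delta>0(2)[of x x] by (simp add: dist_real_def)
  qed (rule \<delta>0(1))
  have "\<exists>L. (r \<longlongrightarrow> L) (at 0)"
  proof (rule Cauchy_at_imp_convergent)
    fix k :: real assume "k > 0"
    have "\<bar>c\<bar> + 1 > 0" by simp
    from pairing_small[OF \<open>k > 0\<close> this] obtain \<delta> where \<delta>: "\<delta> > 0"
      "\<And>e d ys. e \<noteq> 0 \<Longrightarrow> d \<noteq> 0 \<Longrightarrow> \<bar>e\<bar> < \<delta> \<Longrightarrow> \<bar>d\<bar> < \<delta> \<Longrightarrow> form ys ys \<le> \<bar>c\<bar> + 1 \<Longrightarrow>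
         \<bar>form (quotient_comb t e) ys - form (quotient_comb t d) ys\<bar> \<le> k"
      by blast
    have "\<bar>r e - r d\<bar> \<le> k" if "e \<noteq> 0" "d \<noteq> 0" "\<bar>e\<bar> < \<delta>" "\<bar>d\<bar> < \<delta>" for e d
    proof -
      have "((\<lambda>x. \<bar>form (quotient_comb t e) (quotient_comb 0 x)
          - form (quotient_comb t d) (quotient_comb 0 x)\<bar>) \<longlongrightarrow> \<bar>- r e - - r d\<bar>) (at 0)"
        by (intro tendsto_rabs tendsto_diff lim)
      moreover have "\<forall>\<^sub>F x in at 0. \<bar>form (quotient_comb t e) (quotient_comb 0 x)
          - form (quotient_comb t d) (quotient_comb 0 x)\<bar> \<le> k"
        using norm by eventually_elim (rule \<delta>(2)[OF that])
      ultimately have "\<bar>- r e - - r d\<bar> \<le> k"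
        by (rule tendsto_upperbound) simp
      then show ?thesis by simp
    qed
    then show "\<exists>\<delta>>0. \<forall>e d. e \<noteq> 0 \<longrightarrow> d \<noteq> 0 \<longrightarrow> \<bar>e\<bar> < \<delta> \<longrightarrow> \<bar>d\<bar> < \<delta> \<longrightarrow> \<bar>r e - r d\<bar> \<le> k"
      using \<delta>(1) by blast
  qed
  then show ?thesis
    unfolding r_def real_differentiable_def DERIV_def .
qed

end

section \<open>The second derivative of a radial function along a line\<close>

text \<open>Along the line \<open>e \<mapsto> h + e u\<close> with \<open>h \<noteq> 0\<close> the norm is smooth near \<open>e = 0\<close>, and the chain
  rule splits the second derivative into its radial and its tangential part. At \<open>h = 0\<close> the
  radial function restricts to \<open>f\<close> itself, up to the scaling by \<open>sqrt a\<close>.\<close>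

lemma second_diff_tendsto_bracket:
  fixes \<phi> :: "real \<Rightarrow> real" and h u :: "real ^ 'd"
  assumes d1: "\<And>t. even_ext \<phi> differentiable (at t)"
    and d2: "\<And>t. deriv (even_ext \<phi>) differentiable (at t)"
    and u: "norm u = 1" and a: "a > 0"
  shows "((\<lambda>e. (2 * \<phi> (sqrt a * norm h) - \<phi> (sqrt a * norm (h + e *\<^sub>R u))
             - \<phi> (sqrt a * norm (h - e *\<^sub>R u))) / e\<^sup>2) \<longlongrightarrow> - (a * bracket \<phi> a u h)) (at 0)"
proof -
  define f where "f = even_ext \<phi>"
  have f': "(f has_real_derivative deriv f s) (at s)" for s
    using d1 by (simp add: f_def DERIV_deriv_iff_real_differentiable)
  have f'': "(deriv f has_real_derivative deriv (deriv f) s) (at s)" for s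
    using d2 by (simp add: f_def DERIV_deriv_iff_real_differentiable)
  define g where "g e = f (sqrt a * norm (h + e *\<^sub>R u))" for e
  have g_eq: "g e = \<phi> (sqrt a * norm (h + e *\<^sub>R u))" for e
    using a by (simp add: g_def f_def even_ext_def abs_mult)
  have uu: "u \<bullet> u = 1" using u by (simp add: norm_eq_1)
  have sa: "sqrt a * sqrt a = a" using a by simp
  have "\<exists>g1. (\<forall>\<^sub>F s in nhds 0. (g has_real_derivative g1 s) (at s)) \<and>
      (g1 has_real_derivative a * bracket \<phi> a u h) (at 0)"
  proof (cases "h = 0")
    case True
    have "g = (\<lambda>e. f (sqrt a * e))"
      using a u by (simp add: fun_eq_iff g_def f_def even_ext_def True abs_mult)
    then have "(g has_real_derivative sqrt a * deriv f (sqrt a * s)) (at s)" for s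
      using DERIV_chain2[OF f' DERIV_cmult_Id, of "sqrt a" s] by (simp add: mult.commute)
    moreover have "((\<lambda>s. sqrt a * deriv f (sqrt a * s)) has_real_derivative
        sqrt a * (deriv (deriv f) (sqrt a * 0) * sqrt a)) (at 0)"
      by (rule DERIV_cmult, rule DERIV_chain2[where f = "deriv f"], rule f'')
        (auto intro!: derivative_eq_intros)
    moreover have "sqrt a * (y * sqrt a) = a * y" for y
      using sa by (metis mult.assoc mult.commute)
    then have "sqrt a * (deriv (deriv f) (sqrt a * 0) * sqrt a) = a * bracket \<phi> a u h"
      using True by (simp add: bracket_def phi_d2_def f_def)
    ultimately show ?thesis
      by (intro exI[of _ "\<lambda>s. sqrt a * deriv f (sqrt a * s)"]) simp
  next
    case False
    define R where "R = norm h"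
    define p where "p = h \<bullet> u"
    have "R > 0" using False by (simp add: R_def)
    define N where "N s = norm (h + s *\<^sub>R u)" for s
    have N0: "N 0 = R" by (simp add: N_def R_def)
    have N_sqrt: "N s = sqrt (R\<^sup>2 + 2 * s * p + s\<^sup>2)" for s
      unfolding N_def R_def p_def norm_eq_sqrt_inner
      by (simp add: inner_add_left inner_add_right uu inner_commute power2_eq_square algebra_simps)
    have N': "(N has_real_derivative (p + s) / N s) (at s)" if "N s > 0" for s
    proof -
      have "R\<^sup>2 + 2 * s * p + s\<^sup>2 > 0" using that by (simp add: N_sqrt)
      then have "((\<lambda>s. sqrt (R\<^sup>2 + 2 * s * p + s\<^sup>2)) has_real_derivative
          (p + s) / sqrt (R\<^sup>2 + 2 * s * p + s\<^sup>2)) (at s)"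
        by (auto intro!: derivative_eq_intros simp: field_simps)
      then show ?thesis by (simp add: N_sqrt[abs_def])
    qed
    have "continuous_on UNIV N" unfolding N_def by (intro continuous_intros)
    then have "(N \<longlongrightarrow> N 0) (nhds 0)"
      by (simp add: continuous_on_eq_continuous_at isCont_def tendsto_at_iff_tendsto_nhds)
    then have N_pos: "\<forall>\<^sub>F s in nhds 0. N s > 0"
      using \<open>R > 0\<close> by (intro order_tendstoD(1)) (simp_all add: N0)
    define g1 where "g1 s = deriv f (sqrt a * N s) * (sqrt a * ((p + s) / N s))" for s
    have "\<forall>\<^sub>F s in nhds 0. (g has_real_derivative g1 s) (at s)"
      using N_pos
    proof eventually_elim
      case (elim s)
      show ?case
        unfolding g_def g1_def N_def[symmetric]
        by (rule DERIV_chain2[where f = f], rule f', rule DERIV_cmult, rule N', rule elim)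
    qed
    moreover have "(g1 has_real_derivative a * bracket \<phi> a u h) (at 0)"
    proof -
      have N'0: "(N has_real_derivative p / R) (at 0)"
        using N'[of 0] \<open>R > 0\<close> by (simp add: N0)
      have outer: "((\<lambda>s. deriv f (sqrt a * N s)) has_real_derivative
          deriv (deriv f) (sqrt a * R) * (sqrt a * (p / R))) (at 0)"
        using DERIV_chain2[OF f'' DERIV_cmult[OF N'0], of "sqrt a"] by (simp only: N0)
      have inner: "((\<lambda>s. sqrt a * ((p + s) / N s)) has_real_derivative
          sqrt a * ((R - p * (p / R)) / (R * R))) (at 0)"
        using \<open>R > 0\<close> by (auto intro!: derivative_eq_intros N'0 simp: N0 algebra_simps)
      have "(g1 has_real_derivative
          deriv (deriv f) (sqrt a * R) * (sqrt a * (p / R)) * (sqrt a * (p / R)) +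
          sqrt a * ((R - p * (p / R)) / (R * R)) * deriv f (sqrt a * R)) (at 0)"
        using DERIV_mult[OF outer inner] by (simp add: g1_def[abs_def] N0)
      moreover have "deriv (deriv f) (sqrt a * R) * (sqrt a * (p / R)) * (sqrt a * (p / R)) +
          sqrt a * ((R - p * (p / R)) / (R * R)) * deriv f (sqrt a * R) = a * bracket \<phi> a u h"
      proof -
        have "\<bar>p / R\<bar> \<le> 1"
          using Cauchy_Schwarz_ineq2[of h u] u \<open>R > 0\<close> by (simp add: p_def R_def)
        then have cos: "cos (vec_angle h u) = p / R"
          using u by (simp add: vec_angle_def p_def R_def cos_arccos_abs)
        have sin: "(sin (vec_angle h u))\<^sup>2 = 1 - (p / R)\<^sup>2"
          by (simp add: sin_squared_eq cos)
        have bracket: "bracket \<phi> a u h = (p / R)\<^sup>2 * deriv (deriv f) (sqrt a * R) +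
            (1 - (p / R)\<^sup>2) * (deriv f (sqrt a * R) / (sqrt a * R))"
          using False unfolding bracket_def cos sin phi_d1_def phi_d2_def f_def R_def by simp
        have "y2 * (s * (p / R)) * (s * (p / R)) + s * ((R - p * (p / R)) / (R * R)) * y1
            = (s * s) * ((p / R)\<^sup>2 * y2 + (1 - (p / R)\<^sup>2) * (y1 / (s * R)))"
          if "s > 0" for s y1 y2 :: real
          using \<open>R > 0\<close> that by (simp add: field_simps power2_eq_square)
        from this[of "sqrt a" "deriv (deriv f) (sqrt a * R)" "deriv f (sqrt a * R)"]
        show ?thesis
          unfolding bracket sa using a by simp
      qed
      ultimately show ?thesis by simp
    qed
    ultimately show ?thesis by blast
  qed
  then obtain g1 where g1: "\<forall>\<^sub>F s in nhds 0. (g has_real_derivative g1 s) (at s)"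
    "(g1 has_real_derivative a * bracket \<phi> a u h) (at 0)" by blast
  have "\<forall>\<^sub>F s in nhds 0. g differentiable (at s)"
    using g1(1) by eventually_elim (auto simp: real_differentiable_def)
  moreover have "\<forall>\<^sub>F s in nhds 0. g1 s = deriv g s"
    using g1(1) by eventually_elim (simp add: DERIV_imp_deriv)
  then have "(deriv g has_real_derivative a * bracket \<phi> a u h) (at 0)"
    using g1(2) DERIV_cong_ev[OF refl _ refl] by blast
  ultimately have "((\<lambda>e. (2 * g 0 - g e - g (- e)) / e\<^sup>2) \<longlongrightarrow> - (a * bracket \<phi> a u h)) (at 0)"
    by (rule second_diff_tendsto)
  then show ?thesis by (simp add: g_eq)
qed

section \<open>The covariance of the derivative field\<close>

lemma Phi_scaled_psd:
  assumes "\<phi> \<in> Phi TYPE('d::finite)" "a > 0"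
  shows "psd_kernel (\<lambda>x y :: real ^ 'd. \<phi> (sqrt a * norm (x - y)))"
proof -
  have "psd_kernel (\<lambda>x y :: real ^ 'd. \<phi> (norm (x - y)))"
    using assms(1) by (simp add: Phi_def)
  from psd_kernel_comp[OF this, of "\<lambda>x. sqrt a *\<^sub>R x"]
  show ?thesis
    using assms(2) by (simp add: scaleR_diff_right[symmetric])
qed

text \<open>Restricting the radial kernel to a line gives a positive semidefinite function on the reals.\<close>

lemma Phi_even_ext_psd:
  assumes "\<phi> \<in> Phi TYPE('d::finite)"
  shows "psd_kernel (\<lambda>s t. even_ext \<phi> (s - t))"
proof -
  obtain u :: "real ^ 'd" where u: "norm u = 1" by (metis norm_axis_1)
  have "psd_kernel (\<lambda>x y :: real ^ 'd. \<phi> (norm (x - y)))"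
    using assms by (simp add: Phi_def)
  from psd_kernel_comp[OF this, of "\<lambda>s. s *\<^sub>R u"]
  show ?thesis
    by (simp add: scaleR_diff_left[symmetric] u even_ext_def)
qed

lemma bracket_psd:
  fixes u :: "real ^ 'd"
  assumes \<phi>: "\<phi> \<in> Phi TYPE('d)" and smooth: "twice_differentiable_at (even_ext \<phi>) 0"
    and u: "norm u = 1" and a: "a > 0"
  shows "psd_kernel (\<lambda>x y. - bracket \<phi> a u (x - y))"
proof -
  obtain c where c: "(deriv (even_ext \<phi>) has_real_derivative c) (at 0)"
    using smooth by (auto simp: twice_differentiable_at_def real_differentiable_def)
  interpret smooth_at_origin "even_ext \<phi>" c
    using smooth c Phi_even_ext_psd[OF \<phi>]
    by unfold_locales (auto simp: twice_differentiable_at_def)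
  define C where "C h = \<phi> (sqrt a * norm h)" for h :: "real ^ 'd"
  have "psd_kernel (\<lambda>x y. C (x - y))"
    unfolding C_def by (rule Phi_scaled_psd[OF \<phi> a])
  then have "psd_kernel (\<lambda>x y. (1 / e\<^sup>2) *
      (2 * C (x - y) - C (x - y + e *\<^sub>R u) - C (x - y - e *\<^sub>R u)))" for e
    by (intro psd_kernel_scale psd_kernel_second_diff) auto
  then have "psd_kernel (\<lambda>x y. (2 * C (x - y) - C (x - y + e *\<^sub>R u) - C (x - y - e *\<^sub>R u)) / e\<^sup>2)" for e
    by simp
  moreover have "((\<lambda>e. (2 * C h - C (h + e *\<^sub>R u) - C (h - e *\<^sub>R u)) / e\<^sup>2)
      \<longlongrightarrow> - (a * bracket \<phi> a u h)) (at 0)" for h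
    unfolding C_def
    by (rule second_diff_tendsto_bracket[OF differentiable_everywhere deriv_differentiable_everywhere u a])
  ultimately have "psd_kernel (\<lambda>x y. - (a * bracket \<phi> a u (x - y)))"
    by (intro psd_kernel_limit[where F = "at (0::real)" and
          K = "\<lambda>e x y. (2 * C (x - y) - C (x - y + e *\<^sub>R u) - C (x - y - e *\<^sub>R u)) / e\<^sup>2"]) auto
  from psd_kernel_scale[OF this, of "1 / a"] a show ?thesis by simp
qed

theorem proposition3p3:
  fixes \<phi>1 \<phi>2 :: "real \<Rightarrow> real"
    and u :: "real ^ 'd"
    and a1 a2 b1 b2 :: real
  assumes "\<phi>1 \<in> Phi TYPE('d)"
    and "\<phi>2 \<in> Phi TYPE('d)"
    and "twice_differentiable_at (even_ext \<phi>2) 0"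
    and "norm u = 1"
    and "a1 > 0" and "a2 > 0"
    and "b1 \<ge> 0" and "b2 \<ge> 0"
  shows "stationary_covariance
           (\<lambda>h :: real ^ 'd. b1 * \<phi>1 (sqrt a1 * norm h) - b2 * bracket \<phi>2 a2 u h)"
proof -
  have "psd_kernel (\<lambda>x y :: real ^ 'd. b1 * \<phi>1 (sqrt a1 * norm (x - y)) +
      b2 * - bracket \<phi>2 a2 u (x - y))"
    by (intro psd_kernel_add psd_kernel_scale Phi_scaled_psd bracket_psd assms)
  then show ?thesis by (simp add: stationary_covariance_def)
qed

end
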